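(* Let $n \ge 1$, let $B \subset \mathbb{R}^{n+1}$ be a compact strictly-convex set with non-empty interior, and let $S = \partial B$ (which is homeomorphic to $S^n$). Let $K_1, \dots, K_{n+1}$ be compact subsets of $B$ such that: (a) for each $i$, the set $D_i^0 := K_i \cap S$ is homeomorphic to an $(n-1)$-sphere; let $U_i^+$ and $U_i^-$ denote the two regions (connected components) into which $D_i^0$ separates $S$; (b) for each $i$, there exists a pair $V_i^+, V_i^-$ of disjoint open subsets of $B$ such that $U_i^{+} \subset V_i^{+}$, $U_i^{-} \subset V_i^{-}$, and the boundaries of $V_i^{+}$ and of $V_i^{-}$ (in $B$) are contained in $K_i$; (c) $B$ satisfies the crosspolytope condition (with respect to the sets $D_i^0$, $U_i^\pm$). Then the set $\bigcap_{i=1}^{n+1} K_i$ is non-empty and is contained in the interior of $B$.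
   Context: A subset $B \subset \mathbb{R}^{n+1}$ is strictly-convex if for all $x, y \in B$ every point of the straight line segment from $x$ to $y$, except possibly $x$ and $y$ themselves, lies in the interior of $B$. "Open subset of $B$" and "boundary" of $V_i^\pm$ refer to the subspace topology on $B$. Put $D_i^{\pm} = D_i^0 \cup U_i^{\pm}$. The crosspolytope condition means that the spheres $D_i^0$ are arranged on $S$ such that: - if $I$ is a subset of $\{1, \dots, n+1\}$ of size $k \le n$, then $\bigcap_{i \in I} D_i^0$ is homeomorphic to $S^{n-k}$ (for $I = \emptyset$ the intersection is taken to be $S$); - for each $j$, $\bigcap_{i \ne j} D_i^0$ consists of a pair of (distinct) points $x^{+}, x^{-}$ with $x^{+} \in D_j^{+}$ and $x^{-} \in D_j^{-}$; - $\bigcap_{i=1}^{n+1} D_i^0$ is empty. *)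

theory Defs
  imports "HOL-Analysis.Analysis"
begin

text \<open>\<^term>\<open>open_segment x y\<close> excludes both endpoints (and is empty when \<open>x = y\<close>).\<close>

definition strictly_convex :: "'a::euclidean_space set \<Rightarrow> bool"
  where "strictly_convex B \<longleftrightarrow> (\<forall>x\<in>B. \<forall>y\<in>B. open_segment x y \<subseteq> interior B)"

text \<open>The standard sphere \<^term>\<open>nsphere m\<close> is an abstract topology, so homeomorphism is expressed
  by \<^const>\<open>homeomorphic_space\<close>; \<^term>\<open>nsphere 0\<close> consists of two points.\<close>

definition is_sphere_of_dim :: "'a::topological_space set \<Rightarrow> nat \<Rightarrow> bool"
  where "is_sphere_of_dim X m \<longleftrightarrow> top_of_set X homeomorphic_space nsphere m"

text \<open>The sets \<open>D0 i\<close> are meant to be subsets of \<open>S\<close>, so that the factor \<open>S\<close> in the first clause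
  only matters for \<open>I = {}\<close>, where the intersection is \<open>S\<close> by convention.
  The sets \<open>D0 j \<union> Up j\<close> and \<open>D0 j \<union> Um j\<close> are the closed sides \<open>D\<^sub>j\<^sup>+\<close> and \<open>D\<^sub>j\<^sup>-\<close>.\<close>

definition crosspolytope_condition ::
    "nat \<Rightarrow> 'a::topological_space set \<Rightarrow> (nat \<Rightarrow> 'a set) \<Rightarrow> (nat \<Rightarrow> 'a set) \<Rightarrow> (nat \<Rightarrow> 'a set) \<Rightarrow> bool"
  where "crosspolytope_condition n S D0 Up Um \<longleftrightarrow>
    (\<forall>I. I \<subseteq> {1..n+1} \<and> card I \<le> n \<longrightarrow> is_sphere_of_dim (S \<inter> (\<Inter>i\<in>I. D0 i)) (n - card I)) \<and>
    (\<forall>j\<in>{1..n+1}. \<exists>xp xm. xp \<noteq> xm \<and> (\<Inter>i\<in>{1..n+1} - {j}. D0 i) = {xp, xm} \<and>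
        xp \<in> D0 j \<union> Up j \<and> xm \<in> D0 j \<union> Um j) \<and>
    (\<Inter>i\<in>{1..n+1}. D0 i) = {}"

end

theory Submission
  imports Defs
begin

text \<open>
  Each \<open>K i\<close> is the zero set of a continuous function \<open>g i\<close>, the distance to \<open>K i\<close> taken
  with a plus sign on \<open>V\<^sub>i\<^sup>+\<close> and a minus sign elsewhere; it is continuous because the sign only
  changes across the frontier of \<open>V\<^sub>i\<^sup>+\<close>, where the distance is zero. Together the \<open>g i\<close> form a map
  \<open>f : B \<rightarrow> \<real>\<^bsup>n+1\<^esup>\<close> whose zero set is exactly the intersection of the \<open>K i\<close>. It has no zero on \<open>S\<close>, as
  the \<open>D\<^sub>i\<^sup>0\<close> have no common point, so the common points of the \<open>K i\<close> are interior. If \<open>f\<close> had no zero at all,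
  the restriction of \<open>f\<close> to \<open>S\<close> would extend over the contractible set \<open>B\<close> without zeros. It
  therefore suffices that \<open>f : S \<rightarrow> \<real>\<^bsup>n+1\<^esup> - {0}\<close> has a left homotopy inverse: the identity of the sphere \<open>S\<close>
  would otherwise be homotopic to a constant map (\<open>not_left_homotopy_invertible_if_extends\<close>).

  The left homotopy inverse is built along the flag of spheres
  \<open>M k = S \<inter> D\<^sub>k\<^sub>+\<^sub>1\<^sup>0 \<inter> \<dots> \<inter> D\<^sub>n\<^sub>+\<^sub>1\<^sup>0\<close>, of dimension \<open>k - 1\<close> by the crosspolytope condition.
  On \<open>M k\<close> only the first \<open>k\<close> coordinates of \<open>f\<close> can be nonzero, so \<open>f\<close> maps \<open>M k\<close> into \<open>E k - {0}\<close>, where \<open>E k\<close> is a copy of \<open>\<real>\<^bsup>k\<^esup>\<close>, and \<open>M k\<close> is the part of \<open>M (k+1)\<close> on which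
  the coordinate \<open>k+1\<close> vanishes. The induction starts at \<open>M 0 = {}\<close>.

  The step from \<open>M k\<close> to \<open>M (k+1)\<close> is \<open>left_homotopy_invertible_from_equator\<close>. The sphere \<open>M (k+1)\<close> contains
  points \<open>p \<in> U\<^sub>k\<^sub>+\<^sub>1\<^sup>+\<close> and \<open>q \<in> U\<^sub>k\<^sub>+\<^sub>1\<^sup>-\<close>, at which the last coordinate of \<open>f\<close> is positive and negative. The
  standard embedding of the sphere can be modified to a map \<open>\<psi> : M (k+1) \<rightarrow> E (k+1) - {0}\<close> that is still
  left homotopy invertible but meets the axis of the coordinate \<open>k+1\<close> only in \<open>\<psi> p\<close>, on the positive half, and
  \<open>\<psi> q\<close>, on the negative half. The projection \<open>b\<close> of \<open>\<psi>\<close> to \<open>E k\<close> then has no zeros on \<open>M k\<close>. A left homotopy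
  inverse \<open>h\<close> of \<open>f\<close> on \<open>M k\<close> makes \<open>b\<close> factor up to homotopy as \<open>(b \<circ> h) \<circ> f\<close>, and the suspension of \<open>b \<circ> h\<close>
  makes \<open>\<psi>\<close> factor up to homotopy through \<open>f\<close> on all of \<open>M (k+1)\<close> (\<open>suspension_factorisation\<close>).
  A map through which a left homotopy invertible map factors is itself left homotopy invertible.
\<close>

section \<open>Left homotopy inverses\<close>

definition left_homotopy_invertible ::
    "'b::topological_space set \<Rightarrow> 'a::topological_space set \<Rightarrow> ('b \<Rightarrow> 'a) \<Rightarrow> bool"
  where "left_homotopy_invertible X Y f \<longleftrightarrow>
    (\<exists>h. continuous_on Y h \<and> h \<in> Y \<rightarrow> X \<and> homotopic_with_canon (\<lambda>_. True) X X (h \<circ> f) id)"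

lemma left_homotopy_invertible_factor:
  assumes \<psi>: "left_homotopy_invertible X Z \<psi>"
    and \<sigma>: "continuous_on Y \<sigma>" "\<sigma> \<in> Y \<rightarrow> Z"
    and hom: "homotopic_with_canon (\<lambda>_. True) X Z (\<sigma> \<circ> f) \<psi>"
  shows "left_homotopy_invertible X Y f"
proof -
  obtain h where h: "continuous_on Z h" "h \<in> Z \<rightarrow> X"
      and hid: "homotopic_with_canon (\<lambda>_. True) X X (h \<circ> \<psi>) id"
    using \<psi> unfolding left_homotopy_invertible_def by blast
  have "homotopic_with_canon (\<lambda>_. True) X X (h \<circ> (\<sigma> \<circ> f)) (h \<circ> \<psi>)"
    by (rule homotopic_with_compose_continuous_left[OF hom h])
  then have "homotopic_with_canon (\<lambda>_. True) X X ((h \<circ> \<sigma>) \<circ> f) id"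
    using hid by (metis comp_assoc homotopic_with_trans)
  moreover have "continuous_on Y (h \<circ> \<sigma>)"
    using \<sigma> h by (intro continuous_on_compose) (auto intro: continuous_on_subset)
  ultimately show ?thesis
    using \<sigma> h unfolding left_homotopy_invertible_def by (intro exI[of _ "h \<circ> \<sigma>"]) auto
qed

lemma left_homotopy_invertible_homeomorphism:
  assumes \<phi>: "homeomorphism X X' \<phi> \<phi>'" and f: "left_homotopy_invertible X' Y f"
  shows "left_homotopy_invertible X Y (f \<circ> \<phi>)"
proof -
  obtain h where h: "continuous_on Y h" "h \<in> Y \<rightarrow> X'"
      and hid: "homotopic_with_canon (\<lambda>_. True) X' X' (h \<circ> f) id"
    using f unfolding left_homotopy_invertible_def by blast
  have c: "continuous_on X \<phi>" "\<phi> \<in> X \<rightarrow> X'" "continuous_on X' \<phi>'" "\<phi>' \<in> X' \<rightarrow> X"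
    using \<phi> unfolding homeomorphism_def by auto
  have "homotopic_with_canon (\<lambda>_. True) X X (\<phi>' \<circ> ((h \<circ> f) \<circ> \<phi>)) (\<phi>' \<circ> (id \<circ> \<phi>))"
    using c by (intro homotopic_with_compose_continuous_left[OF _ c(3,4)]
        homotopic_with_compose_continuous_right[OF hid])
  then have "homotopic_with_canon (\<lambda>_. True) X X ((\<phi>' \<circ> h) \<circ> (f \<circ> \<phi>)) id"
    by (rule homotopic_with_eq) (use \<phi> in \<open>auto simp: homeomorphism_def\<close>)
  moreover have "continuous_on Y (\<phi>' \<circ> h)"
    using c h by (intro continuous_on_compose) (auto intro: continuous_on_subset)
  ultimately show ?thesis
    using c h unfolding left_homotopy_invertible_def by (intro exI[of _ "\<phi>' \<circ> h"]) auto
qed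

text \<open>If \<open>h\<close> were a left homotopy inverse, then \<open>h \<circ> f\<close>, and with it the identity of \<open>S\<close>, would be homotopic to
  a constant map, because \<open>h \<circ> f\<close> is defined on all of the contractible set \<open>B\<close>.\<close>

lemma not_left_homotopy_invertible_if_extends:
  assumes S: "\<not> contractible S" and SB: "S \<subseteq> B" and B: "contractible B"
    and f: "continuous_on B f" "f \<in> B \<rightarrow> Y"
  shows "\<not> left_homotopy_invertible S Y f"
proof
  assume "left_homotopy_invertible S Y f"
  then obtain h where h: "continuous_on Y h" "h \<in> Y \<rightarrow> S"
      and hid: "homotopic_with_canon (\<lambda>_. True) S S (h \<circ> f) id"
    unfolding left_homotopy_invertible_def by blast
  have "continuous_on B (h \<circ> f)"
    using f h by (intro continuous_on_compose) (auto intro: continuous_on_subset)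
  moreover have "h \<circ> f \<in> B \<rightarrow> S"
    using f(2) h(2) by auto
  ultimately obtain c where "homotopic_with_canon (\<lambda>_. True) B S (h \<circ> f) (\<lambda>_. c)"
    using nullhomotopic_from_contractible[OF _ _ B] by blast
  then have "homotopic_with_canon (\<lambda>_. True) S S (h \<circ> f) (\<lambda>_. c)"
    using SB by (rule homotopic_with_subset_left)
  then have "homotopic_with_canon (\<lambda>_. True) S S id (\<lambda>_. c)"
    using hid homotopic_with_symD homotopic_with_trans by blast
  with S show False
    unfolding contractible_def by blast
qed

section \<open>Suspension of a homotopy factorisation\<close>

text \<open>A homotopy between \<open>a\<close> and \<open>b\<close> without zeros on the closed part \<open>N\<close> extends to one on \<open>M\<close> as long as
  zeros outside \<open>N\<close> are allowed, since \<open>E\<close> is convex. Away from \<open>N\<close> these zeros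
  will be harmless because an extra coordinate, orthogonal to \<open>E\<close>, does not vanish there.\<close>

lemma homotopic_extension_into_subspace:
  fixes a b :: "'b::euclidean_space \<Rightarrow> 'a::euclidean_space"
  assumes E: "subspace E" and NM: "closedin (top_of_set M) N"
    and a: "continuous_on M a" "a ` M \<subseteq> E" and b: "continuous_on M b" "b ` M \<subseteq> E"
    and hom: "homotopic_with_canon (\<lambda>_. True) N (E - {0}) a b"
  obtains H where "continuous_on ({0..1::real} \<times> M) H" "H ` ({0..1} \<times> M) \<subseteq> E"
    "\<And>x. x \<in> M \<Longrightarrow> H (0, x) = a x" "\<And>x. x \<in> M \<Longrightarrow> H (1, x) = b x"
    "\<And>t x. t \<in> {0..1} \<Longrightarrow> x \<in> N \<Longrightarrow> H (t, x) \<noteq> 0"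
proof -
  have "\<exists>K. continuous_on ({0..1::real} \<times> N) K \<and> K \<in> {0..1} \<times> N \<rightarrow> E - {0} \<and>
      (\<forall>x\<in>N. K (0, x) = a x) \<and> (\<forall>x\<in>N. K (1, x) = b x)"
    using hom by (simp add: homotopic_with)
  then obtain K where K: "continuous_on ({0..1::real} \<times> N) K" "K \<in> {0..1} \<times> N \<rightarrow> E - {0}"
      and K0: "\<And>x. x \<in> N \<Longrightarrow> K (0, x) = a x" and K1: "\<And>x. x \<in> N \<Longrightarrow> K (1, x) = b x"
    by blast
  have NsubM: "N \<subseteq> M"
    using NM closedin_imp_subset by blast
  have "closedin (top_of_set ({0..1::real} \<times> M)) ({0..1} \<times> N)"
    using NM by (intro closedin_Times) auto
  then obtain L where L: "continuous_on ({0..1} \<times> M) L" "L ` ({0..1} \<times> M) \<subseteq> E"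
      and LK: "\<And>y. y \<in> {0..1} \<times> N \<Longrightarrow> L y = K y"
    using Dugundji[OF subspace_imp_convex[OF E] _ _ K(1)] K(2) subspace_0[OF E] by (auto simp: image_subset_iff_funcset)
  \<comment> \<open>\<open>L\<close> extends the homotopy from \<open>N\<close>; the two further terms vanish on \<open>N\<close> and
    correct the ends of \<open>L\<close> to \<open>a\<close> and \<open>b\<close>.\<close>
  define H where "H = (\<lambda>(t, x). L (t, x) + (1 - t) *\<^sub>R (a x - L (0, x)) + t *\<^sub>R (b x - L (1, x)))"
  show thesis
  proof
    have contL: "continuous_on ({0..1::real} \<times> M) (\<lambda>y. L (c, snd y))" if "c \<in> {0..1}" for c
      by (rule continuous_on_compose2[OF L(1)]) (use that in \<open>auto intro!: continuous_intros\<close>)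
    have "continuous_on ({0..1::real} \<times> M) (\<lambda>y. a (snd y))" "continuous_on ({0..1::real} \<times> M) (\<lambda>y. b (snd y))"
      by (auto intro!: continuous_on_compose2[OF a(1)] continuous_on_compose2[OF b(1)] continuous_intros)
    then show "continuous_on ({0..1} \<times> M) H"
      unfolding H_def case_prod_unfold using L(1) contL[of 0] contL[of 1] by (auto intro!: continuous_intros)
    have LE: "L (t, x) \<in> E" if "t \<in> {0..1}" "x \<in> M" for t x
      using L(2) that by blast
    show "H ` ({0..1} \<times> M) \<subseteq> E"
      unfolding H_def using LE a(2) b(2)
      by (auto intro!: subspace_add[OF E] subspace_diff[OF E] subspace_scale[OF E])
    show "H (t, x) \<noteq> 0" if "t \<in> {0..1}" "x \<in> N" for t x
      using that K(2) by (auto simp: H_def LK K0 K1)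
  qed (auto simp: H_def)
qed

text \<open>Let \<open>h\<close> be a left homotopy inverse of \<open>f\<close> over the equator \<open>f x \<in> E\<close>, and \<open>b\<close> the projection of \<open>\<psi>\<close> to \<open>E\<close>.
  There \<open>(b \<circ> h) \<circ> f\<close> is homotopic to \<open>b\<close>. The map \<open>\<sigma>\<close> is a suspension of \<open>b \<circ> h\<close>: it keeps the
  coordinate along \<open>u\<close> and extends \<open>b \<circ> h\<close> arbitrarily in the \<open>E\<close> direction. First the homotopy over the
  equator is extended, with the last coordinate \<open>f x \<bullet> u\<close> kept fixed; then the last coordinate is moved
  linearly from \<open>f x \<bullet> u\<close> to \<open>\<psi> x \<bullet> u\<close>, which avoids \<open>0\<close> because the two have the same sign wherever \<open>b\<close>
  vanishes.\<close>

lemma suspension_factorisation: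
  fixes f \<psi> :: "'b::euclidean_space \<Rightarrow> 'a::euclidean_space"
  assumes E': "subspace E'" "u \<in> E'" "norm u = 1"
    and E: "E = {v \<in> E'. v \<bullet> u = 0}"
    and f: "continuous_on M f" "f \<in> M \<rightarrow> E' - {0}"
    and \<psi>: "continuous_on M \<psi>" "\<psi> \<in> M \<rightarrow> E' - {0}"
    and inv: "left_homotopy_invertible {x \<in> M. f x \<in> E} (E - {0}) f"
    and same_sign: "\<And>x. x \<in> M \<Longrightarrow> \<psi> x = (\<psi> x \<bullet> u) *\<^sub>R u \<Longrightarrow> (f x \<bullet> u) * (\<psi> x \<bullet> u) > 0"
  obtains \<sigma> where "continuous_on (E' - {0}) \<sigma>" "\<sigma> \<in> E' - {0} \<rightarrow> E' - {0}"
    "homotopic_with_canon (\<lambda>_. True) M (E' - {0}) (\<sigma> \<circ> f) \<psi>"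
proof -
  define N where "N = {x \<in> M. f x \<in> E}"
  define b where "b = (\<lambda>x. \<psi> x - (\<psi> x \<bullet> u) *\<^sub>R u)"
  have uu: "u \<bullet> u = 1"
    using E'(3) by (simp add: dot_square_norm)
  have subE: "subspace E"
    using E'(1) unfolding E subspace_def by (auto simp: inner_add_left)
  have N_iff: "x \<in> N \<longleftrightarrow> x \<in> M \<and> f x \<bullet> u = 0" for x
    using f(2) unfolding N_def E by auto
  have closedN: "closedin (top_of_set M) N"
  proof -
    have "N = M \<inter> (\<lambda>x. f x \<bullet> u) -` {0}"
      using N_iff by auto
    moreover have "continuous_on M (\<lambda>x. f x \<bullet> u)"
      using f(1) by (intro continuous_intros)
    ultimately show ?thesis
      by (simp add: continuous_closedin_preimage)
  qed
  have bE: "b \<in> M \<rightarrow> E"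
    using \<psi>(2) E'(1,2) unfolding b_def E
    by (auto intro!: subspace_diff subspace_scale simp: inner_diff_left uu)
  have contb: "continuous_on M b"
    unfolding b_def using \<psi>(1) by (auto intro!: continuous_intros)
  have bN: "b \<in> N \<rightarrow> E - {0}"
    using bE same_sign N_iff unfolding b_def by (fastforce simp: Pi_iff)
  obtain h where h: "continuous_on (E - {0}) h" "h \<in> E - {0} \<rightarrow> N"
      and hid: "homotopic_with_canon (\<lambda>_. True) N N (h \<circ> f) id"
    using inv unfolding left_homotopy_invertible_def N_def by blast
  have contbN: "continuous_on N b"
    using contb N_iff by (auto intro: continuous_on_subset)
  have "closedin (top_of_set (E' - {0})) (E - {0})"
  proof -
    have "E - {0} = (E' - {0}) \<inter> (\<lambda>v. v \<bullet> u) -` {0}"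
      unfolding E by auto
    moreover have "continuous_on (E' - {0}) (\<lambda>v. v \<bullet> u)"
      by (intro continuous_intros)
    ultimately show ?thesis
      by (simp add: continuous_closedin_preimage)
  qed
  moreover have "continuous_on (E - {0}) (b \<circ> h)"
    using h contbN by (intro continuous_on_compose) (auto intro: continuous_on_subset)
  moreover have "(b \<circ> h) ` (E - {0}) \<subseteq> E"
    using h(2) bN by (auto simp: Pi_iff)
  ultimately obtain \<beta> where \<beta>: "continuous_on (E' - {0}) \<beta>" "\<beta> ` (E' - {0}) \<subseteq> E"
      and \<beta>bh: "\<And>v. v \<in> E - {0} \<Longrightarrow> \<beta> v = (b \<circ> h) v"
    using Dugundji[OF subspace_imp_convex[OF subE]] subE subspace_0 by (metis empty_iff)
  define \<sigma> where "\<sigma> = (\<lambda>v. \<beta> v + (v \<bullet> u) *\<^sub>R u)"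
  have nonzero: "w + c *\<^sub>R u \<in> E' - {0}" if "w \<in> E" "w \<noteq> 0 \<or> c \<noteq> 0" for w c
  proof -
    have "(w + c *\<^sub>R u) \<bullet> u = c"
      using that(1) unfolding E by (simp add: inner_add_left uu)
    then have "w + c *\<^sub>R u \<noteq> 0"
      using that(2) by auto
    moreover have "w + c *\<^sub>R u \<in> E'"
      using that(1) E' unfolding E by (auto intro!: subspace_add subspace_scale)
    ultimately show ?thesis by simp
  qed
  have hom1: "homotopic_with_canon (\<lambda>_. True) N (E - {0}) (\<beta> \<circ> f) b"
  proof -
    have "homotopic_with_canon (\<lambda>_. True) N (E - {0}) (b \<circ> (h \<circ> f)) (b \<circ> id)"
      by (rule homotopic_with_compose_continuous_left[OF hid contbN bN])
    then show ?thesis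
      by (rule homotopic_with_eq) (use f(2) \<beta>bh in \<open>auto simp: N_def Pi_iff\<close>)
  qed
  have cont\<beta>f: "continuous_on M (\<beta> \<circ> f)"
    using f \<beta>(1) by (intro continuous_on_compose) (auto intro: continuous_on_subset)
  have "(\<beta> \<circ> f) ` M \<subseteq> E"
    using f(2) \<beta>(2) by fastforce
  with homotopic_extension_into_subspace[OF subE closedN cont\<beta>f _ contb _ hom1] bE
  obtain H where H: "continuous_on ({0..1::real} \<times> M) H" "H ` ({0..1} \<times> M) \<subseteq> E"
      and H0: "\<And>x. x \<in> M \<Longrightarrow> H (0, x) = (\<beta> \<circ> f) x" and H1: "\<And>x. x \<in> M \<Longrightarrow> H (1, x) = b x"
      and HN: "\<And>t x. t \<in> {0..1} \<Longrightarrow> x \<in> N \<Longrightarrow> H (t, x) \<noteq> 0"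
    by blast
  have "homotopic_with_canon (\<lambda>_. True) M (E' - {0}) (\<sigma> \<circ> f) (\<lambda>x. b x + (f x \<bullet> u) *\<^sub>R u)"
  proof -
    define H' where "H' = (\<lambda>y. H y + (f (snd y) \<bullet> u) *\<^sub>R u)"
    have "continuous_on ({0..1::real} \<times> M) (\<lambda>y. f (snd y))"
      by (rule continuous_on_compose2[OF f(1)]) (auto intro!: continuous_intros)
    then have "continuous_on ({0..1} \<times> M) H'"
      unfolding H'_def using H(1) by (auto intro!: continuous_intros)
    moreover have "H' (t, x) \<in> E' - {0}" if "t \<in> {0..1}" "x \<in> M" for t x
      unfolding H'_def using that H(2) HN N_iff by (intro nonzero) auto
    ultimately show ?thesis
      by (subst homotopic_with) (auto intro!: exI[of _ H'] simp: image_subset_iff_funcset H'_def H0 H1 \<sigma>_def)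
  qed
  moreover have "homotopic_with_canon (\<lambda>_. True) M (E' - {0}) (\<lambda>x. b x + (f x \<bullet> u) *\<^sub>R u) \<psi>"
  proof (rule homotopic_with_linear)
    fix x assume x: "x \<in> M"
    show "closed_segment (b x + (f x \<bullet> u) *\<^sub>R u) (\<psi> x) \<subseteq> E' - {0}"
    proof
      fix y assume "y \<in> closed_segment (b x + (f x \<bullet> u) *\<^sub>R u) (\<psi> x)"
      then obtain t where t: "0 \<le> t" "t \<le> 1"
          and y: "y = (1 - t) *\<^sub>R (b x + (f x \<bullet> u) *\<^sub>R u) + t *\<^sub>R \<psi> x"
        by (auto simp: closed_segment_def)
      define c where "c = (1 - t) * (f x \<bullet> u) + t * (\<psi> x \<bullet> u)"
      have "y = b x + c *\<^sub>R u"
        unfolding y c_def b_def by (simp add: algebra_simps)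
      moreover have "c \<noteq> 0" if "b x = 0"
      proof -
        have "(f x \<bullet> u) * (\<psi> x \<bullet> u) > 0"
          using same_sign[OF x] that unfolding b_def by simp
        then have "(f x \<bullet> u) * c > 0"
          using t unfolding c_def
          by (cases "t = 0") (auto simp: distrib_left mult.left_commute zero_less_mult_iff intro!: add_nonneg_pos)
        then show ?thesis by auto
      qed
      ultimately show "y \<in> E' - {0}"
        using nonzero[of "b x" c] bE x by auto
    qed
  qed (use contb f(1) \<psi>(1) in \<open>auto intro!: continuous_intros\<close>)
  ultimately have "homotopic_with_canon (\<lambda>_. True) M (E' - {0}) (\<sigma> \<circ> f) \<psi>"
    by (rule homotopic_with_trans)
  moreover have "continuous_on (E' - {0}) \<sigma>"
    unfolding \<sigma>_def using \<beta>(1) by (auto intro!: continuous_intros)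
  moreover have "\<sigma> \<in> E' - {0} \<rightarrow> E' - {0}"
  proof
    fix v assume v: "v \<in> E' - {0}"
    show "\<sigma> v \<in> E' - {0}"
      unfolding \<sigma>_def
    proof (rule nonzero)
      show "\<beta> v \<in> E" using \<beta>(2) v by blast
      show "\<beta> v \<noteq> 0 \<or> v \<bullet> u \<noteq> 0"
        using v h(2) bN \<beta>bh[of v] unfolding E by (auto simp: Pi_iff)
    qed
  qed
  ultimately show thesis
    using that by blast
qed

section \<open>Moving two points of a sphere to the poles\<close>

text \<open>The reflection in the hyperplane orthogonal to \<open>c - u\<close>, which exchanges \<open>c\<close> and \<open>u\<close>. An explicit formula is
  used because the reflection has to preserve every subspace that contains both vectors.\<close>

lemma householder_reflection:
  fixes c u :: "'a::real_inner"
  assumes c: "norm c = 1" and u: "norm u = 1"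
  obtains R where "bounded_linear R" "\<And>v. R (R v) = v" "\<And>v. R v \<bullet> u = v \<bullet> c" "R u = c"
    "\<And>E v. subspace E \<Longrightarrow> c \<in> E \<Longrightarrow> u \<in> E \<Longrightarrow> v \<in> E \<Longrightarrow> R v \<in> E"
proof
  define w where "w = c - u"
  \<comment> \<open>If \<open>c = u\<close>, then \<open>k = 0\<close> by the convention for division by zero and \<open>R\<close> is the identity, as required.\<close>
  define k where "k = 2 / (w \<bullet> w)"
  define R where "R = (\<lambda>v. v - ((v \<bullet> w) * k) *\<^sub>R w)"
  have Rv: "R v = v - ((v \<bullet> w) * k) *\<^sub>R w" for v
    by (simp add: R_def)
  have unit: "c \<bullet> c = 1" "u \<bullet> u = 1"
    using assms by (simp_all add: dot_square_norm)
  have kw: "w = 0 \<or> k * (w \<bullet> w) = 2"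
    by (simp add: k_def)
  have "w \<bullet> w = - 2 * (w \<bullet> u)"
    unfolding w_def by (simp add: inner_diff_left inner_diff_right inner_commute unit)
  with kw have kwu: "w = 0 \<or> k * (w \<bullet> u) = -1"
    by auto
  show "bounded_linear R"
    unfolding R_def
    by (intro bounded_linear_sub bounded_linear_ident bounded_linear_scaleR_const
        bounded_linear_mult_const bounded_linear_inner_left)
  show "R (R v) = v" for v
  proof -
    have Rvw: "R v \<bullet> w = (v \<bullet> w) - (v \<bullet> w) * (k * (w \<bullet> w))"
      unfolding R_def by (simp add: inner_diff_left)
    have "R (R v) = v - ((v \<bullet> w) * k * (2 - k * (w \<bullet> w))) *\<^sub>R w"
      unfolding Rv[of "R v"] Rvw unfolding Rv[of v] by (simp add: algebra_simps flip: scaleR_add_left)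
    then show ?thesis
      using kw by auto
  qed
  show "R u = c"
    using kwu unfolding R_def by (auto simp: w_def inner_commute mult.commute)
  show "R v \<bullet> u = v \<bullet> c" for v
  proof -
    have "R v \<bullet> u = v \<bullet> u - (v \<bullet> w) * (k * (w \<bullet> u))"
      unfolding R_def by (simp add: inner_diff_left)
    then show ?thesis
      using kwu by (auto simp: w_def inner_diff_right)
  qed
  show "R v \<in> E" if "subspace E" "c \<in> E" "u \<in> E" "v \<in> E" for E v
    unfolding R_def w_def using that by (auto intro!: subspace_diff subspace_scale)
qed

text \<open>The midpoint \<open>m\<close> of \<open>P\<close> and \<open>Q\<close> lies in the open unit ball, so translation by \<open>- m\<close> is homotopic to the
  inclusion of the sphere in the complement of the origin and keeps the radial projection as a left
  homotopy inverse. The line through \<open>P\<close> and \<open>Q\<close> becomes a line through the origin, which still meets the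
  sphere only in \<open>P\<close> and \<open>Q\<close>, and a reflection turns it into the axis spanned by \<open>u\<close>.\<close>

lemma sphere_map_with_prescribed_axis:
  fixes u :: "'a::euclidean_space"
  assumes E: "subspace E" "u \<in> E" "norm u = 1"
    and PQ: "P \<in> sphere 0 1 \<inter> E" "Q \<in> sphere 0 1 \<inter> E" "P \<noteq> Q"
  obtains \<rho> where "continuous_on (sphere 0 1 \<inter> E) \<rho>" "\<rho> \<in> sphere 0 1 \<inter> E \<rightarrow> E - {0}"
    "left_homotopy_invertible (sphere 0 1 \<inter> E) (E - {0}) \<rho>"
    "\<And>x. x \<in> sphere 0 1 \<inter> E \<Longrightarrow> \<rho> x = (\<rho> x \<bullet> u) *\<^sub>R u \<Longrightarrow>
       x = P \<and> \<rho> x \<bullet> u > 0 \<or> x = Q \<and> \<rho> x \<bullet> u < 0"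
proof -
  let ?S = "sphere 0 1 \<inter> E"
  define m where "m = (1/2) *\<^sub>R (P + Q)"
  define d where "d = norm (P - Q) / 2"
  define c where "c = (1 / (2 * d)) *\<^sub>R (P - Q)"
  have d: "d > 0"
    using PQ(3) by (simp add: d_def)
  have c: "norm c = 1" "c \<in> E"
    using PQ E(1) by (auto simp: c_def d_def intro!: subspace_scale subspace_diff)
  have mE: "m \<in> E"
    using PQ E(1) by (auto simp: m_def intro!: subspace_scale subspace_add)
  have P: "P = m + d *\<^sub>R c" and Q: "Q = m - d *\<^sub>R c"
    using d by (simp_all add: m_def c_def scaleR_right_distrib scaleR_right_diff_distrib flip: scaleR_left_distrib)
  have one: "P \<bullet> P = 1" "Q \<bullet> Q = 1" "c \<bullet> c = 1"
    using PQ c by (auto simp: dot_square_norm)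
  have mc: "m \<bullet> c = 0"
    by (simp add: m_def c_def inner_diff_right inner_add_left one inner_commute[of Q P])
  have md: "m \<bullet> m + d\<^sup>2 = 1"
    using one(1) mc one(3) unfolding P
    by (simp add: inner_add_left inner_add_right inner_commute power2_eq_square)
  have "m \<bullet> m < 1"
    using md zero_less_power[OF d, of 2] by linarith
  then have m1: "norm m < 1"
    by (simp add: norm_lt_square)
  obtain R where R: "bounded_linear R" "\<And>v. R (R v) = v" "\<And>v. R v \<bullet> u = v \<bullet> c" "R u = c"
      and RE: "\<And>v. v \<in> E \<Longrightarrow> R v \<in> E"
    using householder_reflection[OF c(1) E(3)] E c(2) by metis
  have R_eq_0: "R v = 0 \<longleftrightarrow> v = 0" for v
    using R(2) linear_simps(3)[OF R(1)] by metis
  define \<rho> where "\<rho> = (\<lambda>x. R (x - m))"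
  show thesis
  proof
    show cont: "continuous_on ?S \<rho>"
      unfolding \<rho>_def by (intro bounded_linear.continuous_on[OF R(1)] continuous_intros)
    have avoid: "x - t *\<^sub>R m \<in> E - {0}" if "x \<in> ?S" "0 \<le> t" "t \<le> 1" for x t
    proof -
      have "norm (t *\<^sub>R m) < 1"
        using m1 that by (simp add: mult_le_one le_less_trans[OF mult_left_le_one_le])
      then have "x \<noteq> t *\<^sub>R m"
        using that by auto
      then show ?thesis
        using that mE E(1) by (auto intro!: subspace_diff subspace_scale)
    qed
    show \<rho>E: "\<rho> \<in> ?S \<rightarrow> E - {0}"
      using avoid[of _ 1] RE unfolding \<rho>_def by (auto simp: R_eq_0)
    show "left_homotopy_invertible ?S (E - {0}) \<rho>"
      unfolding left_homotopy_invertible_def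
    proof (intro exI conjI)
      show "continuous_on (E - {0}) (sgn \<circ> R)"
        unfolding o_def by (intro continuous_intros bounded_linear.continuous_on[OF R(1)]) (auto simp: R_eq_0)
      show "sgn \<circ> R \<in> E - {0} \<rightarrow> ?S"
        using RE E(1) by (auto simp: R_eq_0 sgn_div_norm subspace_scale)
      have "homotopic_with_canon (\<lambda>_. True) ?S (E - {0}) (\<lambda>x. x - m) id"
      proof (rule homotopic_with_linear)
        fix x assume x: "x \<in> ?S"
        show "closed_segment (x - m) (id x) \<subseteq> E - {0}"
        proof
          fix y assume "y \<in> closed_segment (x - m) (id x)"
          then obtain t where t: "0 \<le> t" "t \<le> 1" "y = (1 - t) *\<^sub>R (x - m) + t *\<^sub>R x"
            by (auto simp: closed_segment_def)
          then have "y = x - (1 - t) *\<^sub>R m"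
            by (simp add: algebra_simps)
          then show "y \<in> E - {0}"
            using avoid[OF x, of "1 - t"] t by simp
        qed
      qed (auto intro!: continuous_intros)
      then have "homotopic_with_canon (\<lambda>_. True) ?S ?S (sgn \<circ> (\<lambda>x. x - m)) (sgn \<circ> id)"
        by (rule homotopic_with_compose_continuous_left)
          (use E(1) in \<open>auto intro!: continuous_intros simp: sgn_div_norm subspace_scale\<close>)
      then show "homotopic_with_canon (\<lambda>_. True) ?S ?S ((sgn \<circ> R) \<circ> \<rho>) id"
        by (rule homotopic_with_eq) (auto simp: \<rho>_def R(2) sgn_div_norm)
    qed
    fix x assume x: "x \<in> ?S" and ax: "\<rho> x = (\<rho> x \<bullet> u) *\<^sub>R u"
    define s where "s = \<rho> x \<bullet> u"
    have "R (\<rho> x) = s *\<^sub>R c"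
      using ax R(4) linear_simps(5)[OF R(1)] unfolding s_def by metis
    then have xs: "x = m + s *\<^sub>R c"
      by (simp add: \<rho>_def R(2) algebra_simps)
    have "x \<bullet> x = 1"
      using x by (simp add: dot_square_norm)
    then have "s\<^sup>2 = d\<^sup>2"
      using md mc one(3) unfolding xs
      by (simp add: inner_add_left inner_add_right inner_commute power2_eq_square)
    then have "s = d \<or> s = - d"
      by (simp add: power2_eq_iff)
    then show "x = P \<and> \<rho> x \<bullet> u > 0 \<or> x = Q \<and> \<rho> x \<bullet> u < 0"
      using d xs P Q unfolding s_def by auto
  qed
qed

text \<open>The two points \<open>p\<close> and \<open>q\<close> alone tie the last coordinate of \<open>f\<close> to the topology of the sphere \<open>M\<close>: with \<open>p\<close>
  and \<open>q\<close> moved to the poles, \<open>f\<close> and the comparison map have last coordinates of the same sign at the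
  poles, and \<open>suspension_factorisation\<close> applies.\<close>

lemma left_homotopy_invertible_from_equator:
  fixes f :: "'b::euclidean_space \<Rightarrow> 'a::euclidean_space"
  assumes E': "subspace E'" "u \<in> E'" "norm u = 1"
    and E: "E = {v \<in> E'. v \<bullet> u = 0}"
    and f: "continuous_on M f" "f \<in> M \<rightarrow> E' - {0}"
    and M: "M homeomorphic (sphere 0 1 \<inter> E')"
    and inv: "left_homotopy_invertible {x \<in> M. f x \<in> E} (E - {0}) f"
    and p: "p \<in> M" "f p \<bullet> u > 0" and q: "q \<in> M" "f q \<bullet> u < 0"
  shows "left_homotopy_invertible M (E' - {0}) f"
proof -
  obtain \<phi> \<phi>' where \<phi>: "homeomorphism M (sphere 0 1 \<inter> E') \<phi> \<phi>'"
    using M unfolding homeomorphic_def by blast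
  then have contphi: "continuous_on M \<phi>" and img: "\<phi> ` M = sphere 0 1 \<inter> E'"
      and inj: "\<And>x y. x \<in> M \<Longrightarrow> y \<in> M \<Longrightarrow> \<phi> x = \<phi> y \<longleftrightarrow> x = y"
    by (auto simp: homeomorphism_def)
  have "p \<noteq> q"
    using p q by auto
  then obtain \<rho> where \<rho>: "continuous_on (sphere 0 1 \<inter> E') \<rho>" "\<rho> \<in> sphere 0 1 \<inter> E' \<rightarrow> E' - {0}"
    "left_homotopy_invertible (sphere 0 1 \<inter> E') (E' - {0}) \<rho>"
    "\<And>x. x \<in> sphere 0 1 \<inter> E' \<Longrightarrow> \<rho> x = (\<rho> x \<bullet> u) *\<^sub>R u \<Longrightarrow>
       x = \<phi> p \<and> \<rho> x \<bullet> u > 0 \<or> x = \<phi> q \<and> \<rho> x \<bullet> u < 0"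
    using sphere_map_with_prescribed_axis[OF E', of "\<phi> p" "\<phi> q"] img p(1) q(1) inj by (metis imageI)
  have "continuous_on M (\<rho> \<circ> \<phi>)"
    using contphi \<rho>(1) img by (intro continuous_on_compose) auto
  moreover have "\<rho> \<circ> \<phi> \<in> M \<rightarrow> E' - {0}"
    using \<rho>(2) img by (auto simp: Pi_iff)
  moreover have "(f x \<bullet> u) * ((\<rho> \<circ> \<phi>) x \<bullet> u) > 0"
    if "x \<in> M" "(\<rho> \<circ> \<phi>) x = ((\<rho> \<circ> \<phi>) x \<bullet> u) *\<^sub>R u" for x
  proof -
    have "\<phi> x = \<phi> p \<and> \<rho> (\<phi> x) \<bullet> u > 0 \<or> \<phi> x = \<phi> q \<and> \<rho> (\<phi> x) \<bullet> u < 0"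
      using \<rho>(4)[of "\<phi> x"] that img by (metis comp_apply imageI)
    then show ?thesis
      using inj that(1) p q by (auto simp: zero_less_mult_iff)
  qed
  ultimately obtain \<sigma> where \<sigma>: "continuous_on (E' - {0}) \<sigma>" "\<sigma> \<in> E' - {0} \<rightarrow> E' - {0}"
    "homotopic_with_canon (\<lambda>_. True) M (E' - {0}) (\<sigma> \<circ> f) (\<rho> \<circ> \<phi>)"
    using suspension_factorisation[OF E' E f _ _ inv] by metis
  show ?thesis
    by (rule left_homotopy_invertible_factor[OF left_homotopy_invertible_homeomorphism[OF \<phi> \<rho>(3)] \<sigma>])
qed

section \<open>Signed distances and coordinate spheres\<close>

lemma signed_distance_function:
  fixes K :: "'a::metric_space set"
  assumes K: "closed K" "K \<noteq> {}" and fr: "(top_of_set B) frontier_of V \<subseteq> K"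
  obtains g :: "'a \<Rightarrow> real" where "continuous_on B g" "\<And>x. g x = 0 \<longleftrightarrow> x \<in> K"
    "\<And>x. x \<in> V - K \<Longrightarrow> g x > 0" "\<And>x. x \<notin> V \<union> K \<Longrightarrow> g x < 0"
proof
  define g where "g = (\<lambda>x. if x \<in> V then infdist x K else - infdist x K)"
  have zero: "infdist x K = 0 \<longleftrightarrow> x \<in> K" for x
    using in_closed_iff_infdist_zero[OF K] by simp
  then have pos: "x \<notin> K \<Longrightarrow> infdist x K > 0" for x
    by (metis infdist_nonneg order_le_less)
  have "continuous_map (top_of_set B) euclidean g"
    unfolding g_def
  proof (rule continuous_map_cases)
    fix x assume "x \<in> top_of_set B frontier_of {x. x \<in> V}"
    then have "x \<in> K" using fr by auto
    then show "infdist x K = - infdist x K" using zero by simp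
  qed (auto simp: subtopology_subtopology intro!: continuous_intros)
  then show "continuous_on B g" by simp
  show "g x = 0 \<longleftrightarrow> x \<in> K" for x
    using zero by (simp add: g_def)
  show "g x > 0" if "x \<in> V - K" for x
    using that pos by (simp add: g_def)
  show "g x < 0" if "x \<notin> V \<union> K" for x
    using that pos by (simp add: g_def)
qed

text \<open>The standard spheres consist of sequences, whereas the induction over the dimension takes place in
  coordinate subspaces of one fixed Euclidean space. The enumeration \<open>idx\<close> of the coordinates starts at 1
  and sequences start at 0, whence the shift.\<close>

lemma nsphere_homeomorphic_coordinate_sphere:
  fixes idx :: "'m::finite \<Rightarrow> nat"
  assumes idx: "bij_betw idx UNIV {1..N}" and k: "k < N"
  shows "nsphere k homeomorphic_space
    top_of_set (sphere 0 1 \<inter> {v::real^'m. \<forall>a. idx a > Suc k \<longrightarrow> v $ a = 0})"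
proof -
  define X where "X = {x::nat \<Rightarrow> real. (\<Sum>i\<le>k. (x i)\<^sup>2) = 1 \<and> (\<forall>i>k. x i = 0)}"
  define E where "E = {v::real^'m. \<forall>a. idx a > Suc k \<longrightarrow> v $ a = 0}"
  define j where "j = inv_into UNIV idx"
  have j: "idx (j i) = i" if "1 \<le> i" "i \<le> N" for i
    using that idx unfolding j_def bij_betw_def by (simp add: f_inv_into_f)
  have j': "j (idx a) = a" for a
    using idx unfolding j_def bij_betw_def by simp
  have idx_pos: "1 \<le> idx a" for a
    using idx unfolding bij_betw_def by auto
  define T :: "(nat \<Rightarrow> real) \<Rightarrow> real^'m"
    where "T = (\<lambda>x. \<chi> a. if idx a \<le> Suc k then x (idx a - 1) else 0)"
  define G :: "real^'m \<Rightarrow> nat \<Rightarrow> real"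
    where "G = (\<lambda>v i. if i \<le> k then v $ j (Suc i) else 0)"
  have "Suc (idx a - 1) = idx a" for a
    using idx_pos[of a] by simp
  then have TG: "T (G v) = v" if "v \<in> E" for v
    using that by (auto simp: T_def G_def E_def vec_eq_iff j')
  have GT: "G (T x) = x" if "\<forall>i>k. x i = 0" for x
    using that k by (auto simp: T_def G_def fun_eq_iff j)
  have normT: "(norm (T x))\<^sup>2 = (\<Sum>i\<le>k. (x i)\<^sup>2)" for x
  proof -
    have "(norm (T x))\<^sup>2 = (\<Sum>a\<in>UNIV. if idx a \<le> Suc k then (x (idx a - 1))\<^sup>2 else 0)"
      unfolding power2_norm_eq_inner inner_vec_def T_def
      by (auto simp: power2_eq_square intro!: sum.cong)
    also have "\<dots> = (\<Sum>i\<in>{1..N}. if i \<le> Suc k then (x (i - 1))\<^sup>2 else 0)"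
      by (rule sum.reindex_bij_betw[OF idx])
    also have "\<dots> = (\<Sum>i\<in>{1..Suc k}. (x (i - 1))\<^sup>2)"
      using k by (intro sum.mono_neutral_cong_right) auto
    also have "\<dots> = (\<Sum>i\<le>k. (x i)\<^sup>2)"
      by (rule sum.reindex_bij_witness[of _ Suc "\<lambda>i. i - 1"]) auto
    finally show ?thesis .
  qed
  have "homeomorphic_maps (top_of_set X) (top_of_set (sphere 0 1 \<inter> E)) T G"
    unfolding homeomorphic_maps_def
  proof (intro conjI)
    have "continuous_on X T"
    proof -
      have "continuous_on X (\<lambda>x. if idx a \<le> Suc k then x (idx a - 1) else 0)" for a
        by (cases "idx a \<le> Suc k") (auto intro!: continuous_on_product_coordinates continuous_on_subset[OF continuous_on_product_coordinates])
      then show ?thesis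
        unfolding T_def by (rule continuous_on_vec_lambda)
    qed
    moreover have "T x \<in> sphere 0 1 \<inter> E" if "x \<in> X" for x
    proof -
      have "(norm (T x))\<^sup>2 = 1" using that normT by (simp add: X_def)
      then have "norm (T x) = 1"
        using norm_ge_zero[of "T x"] unfolding power2_eq_1_iff by linarith
      moreover have "T x \<in> E"
        by (simp add: E_def T_def)
      ultimately show ?thesis by simp
    qed
    ultimately show "continuous_map (top_of_set X) (top_of_set (sphere 0 1 \<inter> E)) T"
      by auto
    have "continuous_on (sphere 0 1 \<inter> E) G"
    proof (rule continuous_on_coordinatewise_then_product)
      show "continuous_on (sphere 0 1 \<inter> E) (\<lambda>v. G v i)" for i
        unfolding G_def by (cases "i \<le> k") (auto intro!: continuous_intros)
    qed
    moreover have "G v \<in> X" if "v \<in> sphere 0 1 \<inter> E" for v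
      using normT[of "G v"] TG that by (auto simp: X_def) (simp add: G_def)
    ultimately show "continuous_map (top_of_set (sphere 0 1 \<inter> E)) (top_of_set X) G"
      by auto
  qed (use TG GT in \<open>auto simp: X_def\<close>)
  moreover have "nsphere k = top_of_set X"
    by (simp add: nsphere X_def euclidean_product_topology)
  ultimately show ?thesis
    unfolding homeomorphic_space_def E_def by auto
qed

lemma homeomorphic_space_top_of_set:
  "top_of_set X homeomorphic_space top_of_set Y \<longleftrightarrow> X homeomorphic Y"
proof
  assume "X homeomorphic Y"
  then obtain f g where "homeomorphism X Y f g"
    unfolding homeomorphic_def by blast
  then have "homeomorphic_maps (top_of_set X) (top_of_set Y) f g"
    by (auto simp: homeomorphism_def homeomorphic_maps_def)
  then show "top_of_set X homeomorphic_space top_of_set Y"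
    unfolding homeomorphic_space_def by blast
next
  assume "top_of_set X homeomorphic_space top_of_set Y"
  then obtain f g where "homeomorphic_maps (top_of_set X) (top_of_set Y) f g"
    unfolding homeomorphic_space_def by blast
  then have "homeomorphism X Y f g"
    by (intro homeomorphismI) (auto simp: homeomorphic_maps_def)
  then show "X homeomorphic Y"
    unfolding homeomorphic_def by blast
qed

section \<open>Common points of the separating sets\<close>

lemma strictly_convex_imp_convex: "strictly_convex B \<Longrightarrow> convex B"
  unfolding strictly_convex_def convex_contains_segment closed_segment_eq_open
  using interior_subset by blast

theorem proposition1p4:
  fixes n :: nat
    and B S :: "(real ^ 'm) set"
    and K D0 Up Um :: "nat \<Rightarrow> (real ^ 'm) set"
  assumes n_ge_1: "n \<ge> 1"
    and dim: "CARD('m) = n + 1"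
    and B: "compact B" "strictly_convex B" "interior B \<noteq> {}"
    and S: "S = frontier B"
    and K: "\<And>i. i \<in> {1..n+1} \<Longrightarrow> compact (K i) \<and> K i \<subseteq> B"
    and D0: "\<And>i. i \<in> {1..n+1} \<Longrightarrow> D0 i = K i \<inter> S"
    and D0_sphere: "\<And>i. i \<in> {1..n+1} \<Longrightarrow> is_sphere_of_dim (D0 i) (n - 1)"
    and regions: "\<And>i. i \<in> {1..n+1} \<Longrightarrow> components (S - D0 i) = {Up i, Um i} \<and> Up i \<noteq> Um i"
    and separation: "\<And>i. i \<in> {1..n+1} \<Longrightarrow>
      \<exists>Vp Vm. openin (top_of_set B) Vp \<and> openin (top_of_set B) Vm \<and> Vp \<inter> Vm = {} \<and>
        Up i \<subseteq> Vp \<and> Um i \<subseteq> Vm \<and>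
        (top_of_set B) frontier_of Vp \<subseteq> K i \<and> (top_of_set B) frontier_of Vm \<subseteq> K i"
    and crosspolytope: "crosspolytope_condition n S D0 Up Um"
  shows "(\<Inter>i\<in>{1..n+1}. K i) \<noteq> {} \<and> (\<Inter>i\<in>{1..n+1}. K i) \<subseteq> interior B"
proof
  let ?I = "{1..n+1}"
  have SB: "S \<subseteq> B"
    unfolding S using B(1) by (simp add: compact_imp_closed frontier_subset_closed)
  have spheres: "is_sphere_of_dim (S \<inter> (\<Inter>i\<in>I. D0 i)) (n - card I)" if "I \<subseteq> ?I" "card I \<le> n" for I
    using crosspolytope that unfolding crosspolytope_condition_def by blast
  have no_common: "(\<Inter>i\<in>?I. D0 i) = {}"
    using crosspolytope unfolding crosspolytope_condition_def by simp
  \<comment> \<open>The two points of the crosspolytope condition lie in the open sides, since no point is common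
    to all the \<open>D0 i\<close>.\<close>
  have poles: "\<exists>p q. p \<in> Up j \<and> q \<in> Um j \<and> (\<forall>i\<in>?I - {j}. p \<in> D0 i \<and> q \<in> D0 i)" if j: "j \<in> ?I" for j
  proof -
    obtain p q where pq: "(\<Inter>i\<in>?I - {j}. D0 i) = {p, q}" "p \<in> D0 j \<union> Up j" "q \<in> D0 j \<union> Um j"
      using bspec[OF conjunct1[OF conjunct2[OF crosspolytope[unfolded crosspolytope_condition_def]]] j]
      by (elim exE conjE) (rule that)
    then have "\<forall>i\<in>?I - {j}. p \<in> D0 i \<and> q \<in> D0 i"
      by blast
    moreover from this have "p \<notin> D0 j" "q \<notin> D0 j"
      using no_common by blast+
    ultimately show ?thesis
      using pq by blast
  qed
  show "(\<Inter>i\<in>?I. K i) \<subseteq> interior B"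
  proof
    fix x assume x: "x \<in> (\<Inter>i\<in>?I. K i)"
    then have "x \<in> B"
      using K[of 1] by auto
    moreover have "x \<notin> S"
      using x no_common D0 by blast
    ultimately show "x \<in> interior B"
      using closure_subset unfolding S frontier_def by blast
  qed

  have "\<exists>g. continuous_on B g \<and> (\<forall>x. g x = 0 \<longleftrightarrow> x \<in> K i) \<and>
      (\<forall>x\<in>Up i. g x > 0) \<and> (\<forall>x\<in>Um i. g x < (0::real))" if i: "i \<in> ?I" for i
  proof -
    obtain Vp Vm where V: "Vp \<inter> Vm = {}" "Up i \<subseteq> Vp" "Um i \<subseteq> Vm"
        "(top_of_set B) frontier_of Vp \<subseteq> K i"
      using separation[OF i] by blast
    have "Up i \<subseteq> S - D0 i" "Um i \<subseteq> S - D0 i"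
      using regions[OF i] in_components_subset by blast+
    then have off: "Up i \<inter> K i = {}" "Um i \<inter> K i = {}"
      using D0[OF i] by blast+
    have "K i \<noteq> {}"
      using D0_sphere[OF i] D0[OF i] homeomorphic_empty_space_eq[of "nsphere (n - 1)"]
      unfolding is_sphere_of_dim_def by (auto dest: homeomorphic_empty_space)
    moreover have "closed (K i)"
      using K[OF i] compact_imp_closed by blast
    ultimately obtain g where "continuous_on B g" "\<And>x. g x = 0 \<longleftrightarrow> x \<in> K i"
        "\<And>x. x \<in> Vp - K i \<Longrightarrow> g x > (0::real)" "\<And>x. x \<notin> Vp \<union> K i \<Longrightarrow> g x < 0"
      using signed_distance_function[OF _ _ V(4)] by metis
    with V off show ?thesis
      by (intro exI[of _ g]) blast
  qed
  then have "\<forall>i\<in>?I. \<exists>g. continuous_on B g \<and> (\<forall>x. g x = 0 \<longleftrightarrow> x \<in> K i) \<and>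
      (\<forall>x\<in>Up i. g x > 0) \<and> (\<forall>x\<in>Um i. g x < (0::real))"
    by (rule ballI)
  from bchoice[OF this] obtain g where "\<forall>i\<in>?I. continuous_on B (g i) \<and> (\<forall>x. g i x = 0 \<longleftrightarrow> x \<in> K i) \<and>
      (\<forall>x\<in>Up i. g i x > 0) \<and> (\<forall>x\<in>Um i. g i x < (0::real))"
    by (elim exE)
  then have g: "continuous_on B (g i)" "g i x = 0 \<longleftrightarrow> x \<in> K i"
      "x \<in> Up i \<Longrightarrow> g i x > 0" "x \<in> Um i \<Longrightarrow> g i x < 0" if "i \<in> ?I" for i x
    using that by (simp_all del: atLeastAtMost_iff)
  \<comment> \<open>The coordinates of \<open>real ^ 'm\<close> are numbered like the sets \<open>K i\<close>.\<close>
  have "card (UNIV :: 'm set) = card ?I"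
    using dim by simp
  then obtain idx :: "'m \<Rightarrow> nat" where idx: "bij_betw idx UNIV ?I"
    using finite_same_card_bij[of "UNIV :: 'm set" ?I] by auto
  have idx_in: "idx a \<in> ?I" for a
    using idx by (auto simp: bij_betw_def)
  define f :: "real^'m \<Rightarrow> real^'m" where "f = (\<lambda>x. \<chi> a. g (idx a) x)"
  have f_nth: "f x $ a = g (idx a) x" for x a
    by (simp add: f_def)
  have contf: "continuous_on B f"
    unfolding f_def using g(1) idx_in by (intro continuous_on_vec_lambda) auto
  define E where "E = (\<lambda>k. {v::real^'m. \<forall>a. idx a > k \<longrightarrow> v $ a = 0})"
  define M where "M = (\<lambda>k. {x \<in> S. f x \<in> E k})"
  have all_idx: "(\<forall>a. P (idx a)) \<longleftrightarrow> (\<forall>i\<in>?I. P i)" for P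
    using idx unfolding bij_betw_def by (metis UNIV_I imageE image_eqI)
  have M_iff: "x \<in> M k \<longleftrightarrow> x \<in> S \<and> (\<forall>i\<in>{k+1..n+1}. x \<in> D0 i)" for x k
  proof -
    have "f x \<in> E k \<longleftrightarrow> (\<forall>i\<in>?I. i > k \<longrightarrow> x \<in> K i)"
      unfolding E_def using all_idx[of "\<lambda>i. i > k \<longrightarrow> g i x = 0"] g(2) by (auto simp: f_nth)
    then show ?thesis
      unfolding M_def using D0 by auto
  qed
  have f_nonzero: "f x \<noteq> 0" if "x \<in> S" for x
  proof
    assume "f x = 0"
    then have "\<forall>i\<in>?I. x \<in> D0 i"
      using all_idx[of "\<lambda>i. g i x = 0"] g(2) D0 that by (auto simp: vec_eq_iff f_nth)
    with no_common show False by blast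
  qed
  have M_sphere: "M (Suc k) homeomorphic (sphere 0 1 \<inter> E (Suc k))" if k: "k \<le> n" for k
  proof -
    have "M (Suc k) = S \<inter> (\<Inter>i\<in>{k+2..n+1}. D0 i)"
      using M_iff by auto
    moreover have "is_sphere_of_dim (S \<inter> (\<Inter>i\<in>{k+2..n+1}. D0 i)) k"
      using spheres[of "{k+2..n+1}"] k by auto
    ultimately have "top_of_set (M (Suc k)) homeomorphic_space nsphere k"
      by (simp add: is_sphere_of_dim_def)
    then show ?thesis
      using nsphere_homeomorphic_coordinate_sphere[OF idx, of k] k
      unfolding E_def homeomorphic_space_top_of_set[symmetric] by (auto intro: homeomorphic_space_trans)
  qed
  have subspaceE: "subspace (E k)" for k
    by (auto simp: E_def subspace_def)

  have invertible: "left_homotopy_invertible (M k) (E k - {0}) f" if "k \<le> n + 1" for k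
    using that
  proof (induction k)
    case 0
    have "v = 0" if "v \<in> E 0" for v
    proof -
      have "idx a > 0" for a
        using idx_in[of a] by simp
      then show ?thesis
        using that by (simp add: E_def vec_eq_iff)
    qed
    moreover have "M 0 = {}"
      using M_iff[of _ 0] no_common by fastforce
    ultimately show ?case
      unfolding left_homotopy_invertible_def
      using homotopic_with_canon_on_empty[of "{}" "id \<circ> f" id]
      by (intro exI[of _ id] conjI) auto
  next
    case (Suc k)
    then have k: "Suc k \<in> ?I" by simp
    then obtain a where a: "idx a = Suc k"
      using idx unfolding bij_betw_def by (metis imageE)
    have idx_eq: "idx b = Suc k \<longleftrightarrow> b = a" for b
      using a idx unfolding bij_betw_def by (metis UNIV_I inj_on_eq_iff)
    define u :: "real^'m" where "u = axis a 1"
    have inner_u: "v \<bullet> u = v $ a" for v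
      by (simp add: u_def inner_axis)
    obtain p q where pq: "p \<in> Up (Suc k)" "q \<in> Um (Suc k)" "\<forall>i\<in>?I - {Suc k}. p \<in> D0 i \<and> q \<in> D0 i"
      using poles[OF k] by blast
    have "Up (Suc k) \<subseteq> S" "Um (Suc k) \<subseteq> S"
      using regions[OF k] in_components_subset by blast+
    with pq have pqM: "p \<in> M (Suc k)" "q \<in> M (Suc k)"
      by (auto simp: M_iff)
    have "E k = {v \<in> E (Suc k). v \<bullet> u = 0}"
    proof -
      have "k < idx b \<longleftrightarrow> b = a \<or> Suc k < idx b" for b
        using idx_eq[of b] by linarith
      then show ?thesis
        by (auto simp: E_def inner_u)
    qed
    moreover have "{x \<in> M (Suc k). f x \<in> E k} = M k"
      by (auto simp: M_def E_def)
    moreover have "f \<in> M (Suc k) \<rightarrow> E (Suc k) - {0}"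
      using f_nonzero by (auto simp: M_def)
    moreover have "continuous_on (M (Suc k)) f"
      using contf SB by (auto simp: M_def intro: continuous_on_subset)
    moreover have "u \<in> E (Suc k)" "norm u = 1"
      using a by (auto simp: u_def E_def axis_def norm_axis_1[unfolded axis_def])
    ultimately show ?case
      using left_homotopy_invertible_from_equator[OF subspaceE[of "Suc k"] _ _ _ _ _ M_sphere _ pqM(1) _ pqM(2)]
        Suc g(3)[OF k pq(1)] g(4)[OF k pq(2)] by (simp add: inner_u f_nth a)
  qed
  have "\<not> idx a > n + 1" for a
    using idx_in[of a] by auto
  then have E_top: "E (n + 1) = UNIV"
    by (auto simp: E_def)
  then have M_top: "M (n + 1) = S"
    by (simp add: M_def)
  show "(\<Inter>i\<in>?I. K i) \<noteq> {}"
  proof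
    assume empty: "(\<Inter>i\<in>?I. K i) = {}"
    have "f x \<noteq> 0" for x
    proof
      assume "f x = 0"
      then have "\<forall>i\<in>?I. x \<in> K i"
        using all_idx[of "\<lambda>i. g i x = 0"] g(2) by (auto simp: vec_eq_iff f_nth)
      with empty show False by blast
    qed
    moreover have "S homeomorphic (sphere 0 1 :: (real^'m) set)"
      using M_sphere[of n] E_top M_top by simp
    then have "\<not> contractible S"
      by (simp add: homeomorphic_contractible_eq contractible_sphere)
    ultimately have "\<not> left_homotopy_invertible S (UNIV - {0}) f"
      using not_left_homotopy_invertible_if_extends[OF _ SB _ contf, of "UNIV - {0}"] B(2)
      by (auto simp: strictly_convex_imp_convex convex_imp_contractible)
    then show False
      using invertible[of "n + 1"] E_top M_top by simp
  qed
qed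

end
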